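(* If $n,s\in\mathbb{N}$ and $p\in(0,1]$, then for any $T_n(x)=\sum_{k=-n}^n c_ke^{ikx}\in\mathcal{T}_n$, $$\big\|T_n^{(s)}\big\|_\infty^*\le\sum_{k=-n}^n|c_k|\,|k|^s\lesssim_p n^s\left(1+\left(\frac ns\right)^{1/p}\right)\|T_n\|_p^*.$$
   Context: $\mathcal{T}_n$ is the space of all trigonometric polynomials $T_n(x)=\sum_{k=-n}^n c_k e^{ikx}$ of degree at most $n$ with complex coefficients. For $p\in(0,\infty)$, $\|f\|_p^*:=\left(\int_{-\pi}^{\pi}|f(x)|^p\,dx\right)^{1/p}$, and $\|f\|_\infty^*:=\sup_{x\in[-\pi,\pi]}|f(x)|$. $A\lesssim_pB$ means $A\le CB$ with $C>0$ depending only on $p$ (independent of $n$, $s$ and $T_n$). *)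

theory Defs
  imports "HOL-Analysis.Analysis"
begin

definition trig_poly :: "nat \<Rightarrow> (int \<Rightarrow> complex) \<Rightarrow> real \<Rightarrow> complex" where
  "trig_poly n c x = (\<Sum>k = - int n..int n. c k * exp (\<i> * of_int k * of_real x))"

(* Iterated derivative of a complex-valued function of a real variable; the library constant
   deriv needs equal domain and codomain, hence vector_derivative. *)
definition nth_deriv :: "nat \<Rightarrow> (real \<Rightarrow> complex) \<Rightarrow> real \<Rightarrow> complex" where
  "nth_deriv s f = ((\<lambda>g x. vector_derivative g (at x)) ^^ s) f"

(* Unnormalised measure on [-pi, pi], a quasi-norm only when p < 1. The value is meaningful
   when |f|^p is integrable, as it is for continuous f. *)
definition Lp_norm :: "real \<Rightarrow> (real \<Rightarrow> complex) \<Rightarrow> real" where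
  "Lp_norm p f = (LINT x:{-pi..pi}|lborel. norm (f x) powr p) powr (1 / p)"

(* A real-valued supremum, meaningful when f is bounded on [-pi, pi]. *)
definition sup_norm :: "(real \<Rightarrow> complex) \<Rightarrow> real" where
  "sup_norm f = (SUP x\<in>{-pi..pi}. norm (f x))"

end

theory Submission
  imports
    Defs
    "HOL-Complex_Analysis.Cauchy_Integral_Formula"
    "HOL-Computational_Algebra.Fundamental_Theorem_Algebra"
begin

text \<open>
  The first inequality is termwise: differentiating \<open>s\<close> times multiplies the coefficient of frequency
  \<open>k\<close> by \<open>(\<i> * k) ^ s\<close>.
  
  For the second, the weight \<open>\<bar>k\<bar> ^ s\<close> is concentrated on the frequencies within about \<open>n / s\<close> of \<open>n\<close> or
  \<open>- n\<close>. For \<open>p < 1\<close> a bound uniform over all coefficients, of order \<open>n powr (1 / p - 1)\<close>, is therefore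
  too weak for large \<open>s\<close>; the point is that coefficients near the ends of the spectrum satisfy a better one,
  \<open>\<bar>c k\<bar> \<le> (n - \<bar>k\<bar> + 2) powr (1 / p - 1) * Lp_norm p T\<close>
  (\<open>trig_poly_coeff_bound\<close>). Summing it against the weights gives a sum of order \<open>1 + (n / s) powr (1 / p)\<close>
  (\<open>weighted_exp_sum_le\<close>).
  
  By conjugation it is enough to treat the left end, and there \<open>c k\<close> is the coefficient of index
  \<open>j = k + n\<close> of the algebraic polynomial \<open>P\<close> with \<open>P (cis x) = cis (n * x) * T x\<close>. The claim becomes
  the Hardy--Littlewood estimate for Taylor coefficients in the Hardy space of order \<open>p\<close> (\<open>Hardy_Littlewood_coeff_bound\<close>).
  It rests on the subharmonicity of \<open>\<bar>P\<bar>\<^sup>p\<close>, obtained here by replacing \<open>\<bar>P\<bar>\<^sup>p\<close> with the modulus of a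
  holomorphic majorant that has the same boundary values (\<open>poly_majorant\<close>). For a holomorphic function the
  Poisson formula bounds both its values in the disc (\<open>norm_le_boundary_integral\<close>) and its means over smaller
  circles (\<open>circle_integral_mono\<close>) by the mean over the unit circle.
\<close>

section \<open>The Poisson integral on the unit disc\<close>

definition poisson_kernel :: "complex \<Rightarrow> real \<Rightarrow> real" where
  "poisson_kernel z t = (1 - (norm z)\<^sup>2) / (norm (cis t - z))\<^sup>2"

lemma cis_neq_interior:
  assumes "norm z < 1"
  shows "cis t \<noteq> z"
  using assms by auto

lemma poisson_kernel_pos:
  assumes "norm z < 1"
  shows "0 < poisson_kernel z t"
proof -
  have "(norm z)\<^sup>2 < 1"
    using assms by (simp add: power_less_one_iff)
  then show ?thesis
    using cis_neq_interior[OF assms, of t] by (simp add: poisson_kernel_def)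
qed

lemma continuous_on_poisson_kernel:
  assumes "norm z < 1"
  shows "continuous_on A (poisson_kernel z)"
  unfolding poisson_kernel_def
  by (intro continuous_intros) (use cis_neq_interior[OF assms] in auto)

lemma poisson_kernel_le:
  assumes "norm z < 1"
  shows "poisson_kernel z t \<le> 2 / (1 - norm z)"
proof -
  have "1 - norm z \<le> norm (cis t - z)"
    using norm_triangle_ineq2[of "cis t" z] by simp
  then have "(1 - norm z)\<^sup>2 \<le> (norm (cis t - z))\<^sup>2"
    using assms by (intro power_mono) auto
  then have "poisson_kernel z t \<le> (1 - (norm z)\<^sup>2) / (1 - norm z)\<^sup>2"
    unfolding poisson_kernel_def
    using assms cis_neq_interior[OF assms, of t]
    by (intro divide_left_mono) (auto simp: power_le_one intro!: mult_pos_pos)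
  also have "1 - (norm z)\<^sup>2 = (1 + norm z) * (1 - norm z)"
    by (simp add: algebra_simps power2_eq_square)
  also have "\<dots> / (1 - norm z)\<^sup>2 = (1 + norm z) / (1 - norm z)"
    using assms by (simp add: power2_eq_square)
  also have "\<dots> \<le> 2 / (1 - norm z)"
    using assms by (intro divide_right_mono) auto
  finally show ?thesis .
qed

text \<open>
  This symmetry lets the same kernel be integrated over either variable when the order of
  integration is exchanged in \<open>circle_integral_mono\<close>.
\<close>
lemma poisson_kernel_swap:
  "poisson_kernel (of_real r * cis t) u = poisson_kernel (of_real r * cis u) t"
proof -
  have "(norm (cis u - of_real r * cis t))\<^sup>2 = 1 + r\<^sup>2 - 2 * r * (cos t * cos u + sin t * sin u)" for t u
  proof -
    have "(norm (cis u - of_real r * cis t))\<^sup>2 = (cos u - r * cos t)\<^sup>2 + (sin u - r * sin t)\<^sup>2"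
      by (simp add: cmod_power2)
    then show ?thesis
      using sin_cos_squared_add[of u] sin_cos_squared_add[of t] by algebra
  qed
  from this[of u t] this[of t u]
  have "(norm (cis u - of_real r * cis t))\<^sup>2 = (norm (cis t - of_real r * cis u))\<^sup>2"
    by (simp add: mult.commute)
  then show ?thesis
    by (simp add: poisson_kernel_def norm_mult)
qed

text \<open>
  The factor \<open>(1 - \<bar>z\<bar>\<^sup>2) / (1 - cnj z * w)\<close> is holomorphic in \<open>w\<close> and equals 1 at
  \<open>w = z\<close>, so inserting it into Cauchy's formula at \<open>z\<close> costs nothing; on the unit circle it turns
  the Cauchy kernel into the Poisson kernel. The library's circle path runs over \<open>{0..2 * pi}\<close>,
  whereas \<open>{-pi..pi}\<close> is wanted: Cauchy's formula is therefore applied to \<open>w \<mapsto> g (- w)\<close> at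
  \<open>- z\<close>, and the parameter is shifted by \<open>pi\<close>, which negates \<open>cis\<close>.
\<close>
lemma poisson_formula:
  assumes contg: "continuous_on (cball 0 1) g" and holg: "g holomorphic_on ball 0 1"
    and z: "norm z < 1"
  shows "((\<lambda>t. of_real (poisson_kernel z t) * g (cis t)) has_integral (2 * of_real pi * g z)) {-pi..pi}"
proof -
  define f where "f w = (1 - (norm z)\<^sup>2) * g (- w) / (1 + cnj z * w)" for w
  have nz: "1 + cnj z * w \<noteq> 0" if "norm w \<le> 1" for w
  proof
    assume "1 + cnj z * w = 0"
    then have "norm (cnj z * w) = norm (-1 :: complex)"
      by (metis add_eq_0_iff)
    moreover have "norm (cnj z * w) < 1"
      using z that by (simp add: norm_mult) (metis mult_le_one mult_left_le norm_ge_zero order.strict_trans1)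
    ultimately show False by simp
  qed
  have "continuous_on (cball 0 1) f"
    unfolding f_def using nz
    by (intro continuous_intros continuous_on_compose2[OF contg]) auto
  moreover have "f holomorphic_on ball 0 1"
    unfolding f_def using nz
    by (intro holomorphic_intros holomorphic_on_compose_gen[OF _ holg, unfolded o_def]) auto
  ultimately have "((\<lambda>u. f u / (u - (-z))) has_contour_integral (2 * of_real pi * \<i> * f (-z))) (circlepath 0 1)"
    using z by (intro Cauchy_integral_circlepath) auto
  then have A: "((\<lambda>t. f (cis t) / (cis t + z) * \<i> * cis t) has_integral (2 * of_real pi * \<i> * f (-z))) {0..2*pi}"
    unfolding circlepath_def by (subst (asm) has_contour_integral_part_circlepath_iff) auto
  have "1 - cnj z * z \<noteq> 0"
    using nz[of "- z"] z by simp
  then have fz: "f (-z) = g z"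
    by (simp add: f_def complex_norm_square mult.commute flip: of_real_power)
  have "((\<lambda>t. f (cis t) / (cis t + z) * cis t) has_integral (2 * of_real pi * g z)) {0..2*pi}"
    using has_integral_mult_right[OF A, of "-\<i>"] by (simp add: fz mult_ac)
  then have "((\<lambda>t. f (cis (t + pi)) / (cis (t + pi) + z) * cis (t + pi)) has_integral (2 * of_real pi * g z)) {-pi..pi}"
    using has_integral_affinity'[of _ _ 0 "2*pi" 1 pi] by fastforce
  moreover have "f (cis (t + pi)) / (cis (t + pi) + z) * cis (t + pi) = of_real (poisson_kernel z t) * g (cis t)" for t
  proof -
    have m: "cis (t + pi) = - cis t" by (simp add: cis_mult[symmetric])
    have n: "cis t * cnj (cis t) = 1" by (simp add: cis_cnj cis_mult)
    have "(1 - cnj z * cis t) = cis t * cnj (cis t - z)"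
      by (simp add: algebra_simps n)
    then have "cis t / ((cis t - z) * (1 - cnj z * cis t)) = 1 / ((cis t - z) * cnj (cis t - z))"
      by simp
    also have "\<dots> = of_real (1 / (norm (cis t - z))\<^sup>2)"
      by (simp only: of_real_divide of_real_1 complex_norm_square)
    finally have "cis t / ((cis t - z) * (1 - cnj z * cis t)) = of_real (1 / (norm (cis t - z))\<^sup>2)" .
    moreover have "f (cis (t + pi)) / (cis (t + pi) + z) * cis (t + pi)
       = of_real (1 - (norm z)\<^sup>2) * g (cis t) * (cis t / ((cis t - z) * (1 - cnj z * cis t)))"
    proof -
      have d: "cis (t + pi) + z = - (cis t - z)" by (simp add: m)
      show ?thesis
        unfolding d f_def by (simp add: m del: minus_diff_eq)
    qed
    ultimately show ?thesis
      by (simp add: poisson_kernel_def)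
  qed
  ultimately show ?thesis by simp
qed

lemma poisson_kernel_integral:
  assumes "norm z < 1"
  shows "(poisson_kernel z has_integral (2 * pi)) {-pi..pi}"
proof -
  have "((\<lambda>t. of_real (poisson_kernel z t) * (1::complex)) has_integral (2 * of_real pi * 1)) {-pi..pi}"
    using assms by (intro poisson_formula) auto
  from has_integral_Re[OF this] show ?thesis by simp
qed

lemma norm_le_poisson_integral:
  assumes contg: "continuous_on (cball 0 1) g" and holg: "g holomorphic_on ball 0 1"
    and z: "norm z < 1"
  shows "2 * pi * norm (g z) \<le> integral {-pi..pi} (\<lambda>t. poisson_kernel z t * norm (g (cis t)))"
proof -
  have cg: "continuous_on {-pi..pi} (\<lambda>t. g (cis t))"
    by (intro continuous_intros continuous_on_compose2[OF contg]) auto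
  have "norm (2 * of_real pi * g z) \<le> integral {-pi..pi} (\<lambda>t. poisson_kernel z t * norm (g (cis t)))"
    unfolding integral_unique[OF poisson_formula[OF assms], symmetric]
  proof (rule integral_norm_bound_integral)
    show "(\<lambda>t. of_real (poisson_kernel z t) * g (cis t)) integrable_on {-pi..pi}"
      using poisson_formula[OF assms] by blast
    show "(\<lambda>t. poisson_kernel z t * norm (g (cis t))) integrable_on {-pi..pi}"
      by (intro integrable_continuous_real continuous_intros cg continuous_on_poisson_kernel z)
  qed (use poisson_kernel_pos[OF z] in \<open>auto simp: norm_mult less_imp_le\<close>)
  then show ?thesis by (simp add: norm_mult)
qed

lemma norm_le_boundary_integral:
  assumes contg: "continuous_on (cball 0 1) g" and holg: "g holomorphic_on ball 0 1"
    and z: "norm z < 1"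
  shows "norm (g z) \<le> integral {-pi..pi} (\<lambda>t. norm (g (cis t))) / (1 - norm z)"
proof -
  have cg: "continuous_on {-pi..pi} (\<lambda>t. g (cis t))"
    by (intro continuous_intros continuous_on_compose2[OF contg]) auto
  have nn: "0 \<le> integral {-pi..pi} (\<lambda>t. norm (g (cis t)))"
    by (intro integral_nonneg integrable_continuous_real continuous_intros cg) auto
  have "2 * pi * norm (g z) \<le> integral {-pi..pi} (\<lambda>t. poisson_kernel z t * norm (g (cis t)))"
    by (rule norm_le_poisson_integral[OF assms])
  also have "\<dots> \<le> integral {-pi..pi} (\<lambda>t. 2 / (1 - norm z) * norm (g (cis t)))"
    by (intro integral_le integrable_continuous_real continuous_intros cg
        continuous_on_poisson_kernel z mult_right_mono poisson_kernel_le) auto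
  also have "\<dots> = 2 * (integral {-pi..pi} (\<lambda>t. norm (g (cis t))) / (1 - norm z))"
    by simp
  finally have "pi * norm (g z) \<le> integral {-pi..pi} (\<lambda>t. norm (g (cis t))) / (1 - norm z)"
    by simp
  moreover have "1 * norm (g z) \<le> pi * norm (g z)"
    using pi_gt3 by (intro mult_right_mono) auto
  ultimately show ?thesis by simp
qed

text \<open>
  \<open>\<bar>g\<bar>\<close> on the inner circle is at most the Poisson integral of its boundary values, and after
  exchanging the integrals the Poisson kernel integrates to \<open>2 * pi\<close> for every boundary point.
\<close>
lemma circle_integral_mono:
  assumes contg: "continuous_on (cball 0 1) g" and holg: "g holomorphic_on ball 0 1"
    and r: "0 \<le> r" "r < 1"
  shows "integral {-pi..pi} (\<lambda>u. norm (g (of_real r * cis u))) \<le> integral {-pi..pi} (\<lambda>t. norm (g (cis t)))"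
proof -
  have z: "norm (of_real r * cis u) < 1" for u
    using r by (simp add: norm_mult)
  have cg: "continuous_on {-pi..pi} (\<lambda>t. g (cis t))"
    by (intro continuous_intros continuous_on_compose2[OF contg]) auto
  have cr: "continuous_on {-pi..pi} (\<lambda>u. g (of_real r * cis u))"
    by (intro continuous_intros continuous_on_compose2[OF contg]) (use r in \<open>auto simp: norm_mult\<close>)
  define F where "F u t = poisson_kernel (of_real r * cis u) t * norm (g (cis t))" for u t
  have "continuous_on (cbox (-pi, -pi) (pi, pi)) (\<lambda>(u, t). F u t)"
    unfolding F_def poisson_kernel_def split_def
    by (intro continuous_intros continuous_on_compose2[OF contg])
      (use cis_neq_interior[OF z] in auto)
  then have swap: "integral {-pi..pi} (\<lambda>u. integral {-pi..pi} (F u)) = integral {-pi..pi} (\<lambda>t. integral {-pi..pi} (\<lambda>u. F u t))"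
    and cF: "continuous_on {-pi..pi} (\<lambda>u. integral {-pi..pi} (F u))"
    using integral_swap_continuous[of "-pi" "-pi" pi pi F] integral_continuous_on_param[of "{-pi..pi}" "-pi" pi F]
    by (auto simp: cbox_Pair_eq)
  have "2 * pi * integral {-pi..pi} (\<lambda>u. norm (g (of_real r * cis u)))
      = integral {-pi..pi} (\<lambda>u. 2 * pi * norm (g (of_real r * cis u)))"
    by simp
  also have "\<dots> \<le> integral {-pi..pi} (\<lambda>u. integral {-pi..pi} (F u))"
    unfolding F_def
    by (intro integral_le integrable_continuous_real continuous_intros cr norm_le_poisson_integral contg holg z
      cF[unfolded F_def])
  also have "\<dots> = integral {-pi..pi} (\<lambda>t. integral {-pi..pi} (\<lambda>u. F u t))"
    by (rule swap)
  also have "\<dots> = integral {-pi..pi} (\<lambda>t. 2 * pi * norm (g (cis t)))"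
  proof (rule integral_cong)
    fix t
    have "(\<lambda>u. F u t) = (\<lambda>u. poisson_kernel (of_real r * cis t) u * norm (g (cis t)))"
      by (simp add: F_def poisson_kernel_swap)
    then show "integral {-pi..pi} (\<lambda>u. F u t) = 2 * pi * norm (g (cis t))"
      using integral_unique[OF poisson_kernel_integral[OF z]] by simp
  qed
  finally show ?thesis by simp
qed

section \<open>A holomorphic majorant of the power of a polynomial\<close>

text \<open>
  For \<open>\<bar>a * z\<bar> \<le> 1\<close> the number \<open>1 - a * z\<close> lies in the closed right half plane, away from the branch
  cut except possibly for the point 0, where the power is still continuous because \<open>p > 0\<close>.
\<close>
lemma powr_linear_factor:
  assumes p: "0 < p" and a: "norm a \<le> 1"
  shows "continuous_on (cball 0 1) (\<lambda>z. (1 - a * z) powr of_real p)"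
    and "(\<lambda>z. (1 - a * z) powr of_real p) holomorphic_on ball 0 1"
proof -
  have *: "norm (a * z) \<le> norm z" for z
    using mult_right_mono[OF a norm_ge_zero[of z]] by (simp add: norm_mult)
  have nonneg: "Re (1 - a * z) \<ge> 0" if "norm z \<le> 1" for z
    using *[of z] that complex_Re_le_cmod[of "a * z"] by simp
  have pos: "Re (1 - a * z) > 0" if "norm z < 1" for z
    using *[of z] that complex_Re_le_cmod[of "a * z"] by simp
  show "continuous_on (cball 0 1) (\<lambda>z. (1 - a * z) powr of_real p)"
    using nonneg p by (intro continuous_intros) auto
  show "(\<lambda>z. (1 - a * z) powr of_real p) holomorphic_on ball 0 1"
  proof (intro holomorphic_intros)
    fix z :: complex assume "z \<in> ball 0 1"
    then have "Re (1 - a * z) > 0" by (intro pos) simp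
    then show "1 - a * z \<notin> \<real>\<^sub>\<le>\<^sub>0"
      by (metis complex_nonpos_Reals_iff not_le)
  qed
qed

lemma norm_one_minus_cnj_mult:
  "(norm (1 - cnj w * z))\<^sup>2 - (norm (z - w))\<^sup>2 = (1 - (norm w)\<^sup>2) * (1 - (norm z)\<^sup>2)"
  unfolding cmod_power2 by (simp add: algebra_simps power2_eq_square)

text \<open>
  A root \<open>w\<close> in the closed disc is reflected: \<open>1 - cnj w * z\<close> has the modulus of \<open>z - w\<close> on the
  unit circle and one at least as large inside, but it has no zero inside. A root outside the closed disc only needs to
  be scaled so that \<open>powr_linear_factor\<close> applies.
\<close>
lemma linear_majorant:
  fixes w :: complex and p :: real
  assumes p: "0 < p"
  obtains g where "continuous_on (cball 0 1) g" "g holomorphic_on ball 0 1"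
    "\<And>z. norm z \<le> 1 \<Longrightarrow> norm (z - w) powr p \<le> norm (g z)"
    "\<And>z. norm z = 1 \<Longrightarrow> norm (g z) = norm (z - w) powr p"
proof (cases "norm w \<le> 1")
  case True
  define g where "g z = (1 - cnj w * z) powr of_real p" for z
  have ng: "norm (g z) = norm (1 - cnj w * z) powr p" for z
    by (simp add: g_def norm_powr_real_powr')
  show ?thesis
  proof
    show "continuous_on (cball 0 1) g" "g holomorphic_on ball 0 1"
      using powr_linear_factor[OF p, of "cnj w"] True by (auto simp: g_def[abs_def])
    fix z :: complex
    show "norm (z - w) powr p \<le> norm (g z)" if "norm z \<le> 1"
    proof -
      have "0 \<le> (1 - (norm w)\<^sup>2) * (1 - (norm z)\<^sup>2)"
        using True that by (intro mult_nonneg_nonneg) (auto simp: power_le_one)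
      then have "(norm (z - w))\<^sup>2 \<le> (norm (1 - cnj w * z))\<^sup>2"
        using norm_one_minus_cnj_mult[of w z] by linarith
      then show ?thesis
        using p by (auto simp: ng intro!: powr_mono2 dest: power2_le_imp_le)
    qed
    show "norm (g z) = norm (z - w) powr p" if "norm z = 1"
    proof -
      have "(norm (1 - cnj w * z))\<^sup>2 = (norm (z - w))\<^sup>2"
        using norm_one_minus_cnj_mult[of w z] that by simp
      then have "norm (1 - cnj w * z) = norm (z - w)"
        by (simp only: power2_eq_iff_nonneg norm_ge_zero)
      then show ?thesis by (simp add: ng)
    qed
  qed
next
  case False
  define g where "g z = of_real (norm w powr p) * (1 - inverse w * z) powr of_real p" for z
  have w0: "w \<noteq> 0" using False by auto
  have ng: "norm (g z) = norm (z - w) powr p" for z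
  proof -
    have "w - z = w * (1 - inverse w * z)"
      using w0 by (simp add: field_simps)
    then have "norm (z - w) = norm (w * (1 - inverse w * z))"
      by (metis norm_minus_commute)
    then show ?thesis
      by (simp add: g_def norm_powr_real_powr' norm_mult powr_mult)
  qed
  show ?thesis
  proof
    have "norm (inverse w) \<le> 1"
      using False w0 by (simp add: norm_inverse inverse_le_1_iff)
    note f = powr_linear_factor[OF p this]
    show "continuous_on (cball 0 1) g" "g holomorphic_on ball 0 1"
      unfolding g_def by (intro continuous_intros f holomorphic_intros)+
  qed (auto simp: ng)
qed

text \<open>
  This is the Blaschke factorization in disguise: \<open>\<bar>P\<bar>\<close> to the power \<open>p\<close>, which need not be the modulus of a
  holomorphic function, is dominated in the disc by one that is, without any loss on the circle. The
  property is multiplicative, so linear factors suffice. Working with the powers of the factors avoids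
  choosing a logarithm of a product.
\<close>
lemma poly_majorant:
  fixes P :: "complex poly" and p :: real
  assumes p: "0 < p"
  obtains g where "continuous_on (cball 0 1) g" "g holomorphic_on ball 0 1"
    "\<And>z. norm z \<le> 1 \<Longrightarrow> norm (poly P z) powr p \<le> norm (g z)"
    "\<And>z. norm z = 1 \<Longrightarrow> norm (g z) = norm (poly P z) powr p"
proof -
  have "\<exists>g. continuous_on (cball 0 1) g \<and> g holomorphic_on ball 0 1 \<and>
    (\<forall>z. norm z \<le> 1 \<longrightarrow> norm (poly P z) powr p \<le> norm (g z)) \<and>
    (\<forall>z. norm z = 1 \<longrightarrow> norm (g z) = norm (poly P z) powr p)"
  proof (induction "degree P" arbitrary: P)
    case 0
    then obtain a where a: "P = [:a:]"
      using degree_eq_zeroE by metis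
    show ?case
      by (intro exI[of _ "\<lambda>_. of_real (norm a powr p)"])
        (auto simp: a)
  next
    case (Suc d)
    then have "\<not> constant (poly P)"
      by (simp add: constant_degree)
    then obtain w where "poly P w = 0"
      using Fundamental_Theorem_Algebra.fundamental_theorem_of_algebra by blast
    then obtain Q where Q: "P = [:- w, 1:] * Q"
      by (auto simp: poly_eq_0_iff_dvd)
    have "Q \<noteq> 0" using Suc.hyps(2) Q by auto
    then have "degree P = Suc (degree Q)"
      unfolding Q by (subst degree_mult_eq) auto
    then obtain h where h: "continuous_on (cball 0 1) h" "h holomorphic_on ball 0 1"
      "\<And>z. norm z \<le> 1 \<Longrightarrow> norm (poly Q z) powr p \<le> norm (h z)"
      "\<And>z. norm z = 1 \<Longrightarrow> norm (h z) = norm (poly Q z) powr p"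
      using Suc.hyps by (metis nat.inject)
    obtain g where g: "continuous_on (cball 0 1) g" "g holomorphic_on ball 0 1"
      "\<And>z. norm z \<le> 1 \<Longrightarrow> norm (z - w) powr p \<le> norm (g z)"
      "\<And>z. norm z = 1 \<Longrightarrow> norm (g z) = norm (z - w) powr p"
      using linear_majorant[OF p] by metis
    have P: "norm (poly P z) powr p = norm (z - w) powr p * norm (poly Q z) powr p" for z
    proof -
      have "poly P z = (z - w) * poly Q z"
        by (simp add: Q algebra_simps)
      then show ?thesis by (simp add: norm_mult powr_mult)
    qed
    show ?case
      by (intro exI[of _ "\<lambda>z. g z * h z"])
        (use g h in \<open>auto simp: P norm_mult intro!: mult_mono continuous_intros holomorphic_intros\<close>)
  qed
  then show ?thesis using that by blast
qed

section \<open>Coefficients of a polynomial in terms of its mean of order p on the circle\<close>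

lemma has_vector_derivative_cis_mult:
  "((\<lambda>t. cis (a * t)) has_vector_derivative (\<i> * of_real a * cis (a * t))) (at t within S)"
  unfolding has_vector_derivative_def
  by (auto intro!: derivative_eq_intros simp: scaleR_conv_of_real mult_ac)

lemma has_integral_cis_int:
  "((\<lambda>t. cis (of_int m * t)) has_integral (if m = 0 then 2 * of_real pi else 0)) {-pi..pi}"
proof (cases "m = 0")
  case True
  then show ?thesis
    using has_integral_const_real[of "1::complex" "-pi" pi] by (simp add: scaleR_conv_of_real)
next
  case False
  have "((\<lambda>t. cis (of_int m * t)) has_integral
      (cis (of_int m * pi) / (\<i> * of_int m) - cis (of_int m * (-pi)) / (\<i> * of_int m))) {-pi..pi}"
  proof (rule fundamental_theorem_of_calculus)
    fix t
    show "((\<lambda>t. cis (of_int m * t) / (\<i> * of_int m)) has_vector_derivative cis (of_int m * t)) (at t within {-pi..pi})"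
      using has_vector_derivative_divide[OF has_vector_derivative_cis_mult[of "of_int m" t "{-pi..pi}"], of "\<i> * of_int m"] False
      by simp
  qed auto
  moreover have "cis (of_int m * pi) = cis (of_int m * (-pi))"
    by (simp add: complex_eq_iff sin_zero_iff_int2 mult.commute)
  ultimately show ?thesis using False by simp
qed

lemma poly_coeff_integral:
  fixes P :: "complex poly"
  shows "((\<lambda>t. cis (- (real j * t)) * poly P (of_real r * cis t)) has_integral
           (2 * of_real pi * coeff P j * of_real r ^ j)) {-pi..pi}"
proof -
  have "((\<lambda>t. \<Sum>i\<le>max j (degree P). coeff P i * of_real r ^ i * cis (of_int (int i - int j) * t)) has_integral
      (\<Sum>i\<le>max j (degree P). coeff P i * of_real r ^ i * (if int i - int j = 0 then 2 * of_real pi else 0))) {-pi..pi}"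
    by (intro has_integral_sum has_integral_mult_right has_integral_cis_int) auto
  also have "(\<Sum>i\<le>max j (degree P). coeff P i * of_real r ^ i * (if int i - int j = 0 then 2 * of_real pi else 0)) =
      (\<Sum>i\<le>max j (degree P). if i = j then 2 * of_real pi * coeff P j * of_real r ^ j else 0)"
    by (intro sum.cong) auto
  also have "\<dots> = 2 * of_real pi * coeff P j * of_real r ^ j"
    by simp
  also have "(\<lambda>t. \<Sum>i\<le>max j (degree P). coeff P i * of_real r ^ i * cis (of_int (int i - int j) * t))
     = (\<lambda>t. cis (- (real j * t)) * poly P (of_real r * cis t))"
  proof
    fix t
    have "poly P (of_real r * cis t) = (\<Sum>i\<le>max j (degree P). coeff P i * (of_real r * cis t) ^ i)"
      unfolding poly_altdef by (intro sum.mono_neutral_left) (auto simp: coeff_eq_0)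
    moreover have "cis (of_int (int i - int j) * t) = cis (- (real j * t)) * cis t ^ i" for i
      by (simp add: Complex.DeMoivre cis_mult algebra_simps)
    ultimately show "(\<Sum>i\<le>max j (degree P). coeff P i * of_real r ^ i * cis (of_int (int i - int j) * t))
      = cis (- (real j * t)) * poly P (of_real r * cis t)"
      by (simp add: sum_distrib_left power_mult_distrib mult_ac)
  qed
  finally show ?thesis .
qed

lemma norm_coeff_le_circle_integral:
  fixes P :: "complex poly"
  assumes "0 \<le> r"
  shows "2 * pi * norm (coeff P j) * r ^ j \<le> integral {-pi..pi} (\<lambda>t. norm (poly P (of_real r * cis t)))"
proof -
  have "norm (2 * of_real pi * coeff P j * of_real r ^ j)
     \<le> integral {-pi..pi} (\<lambda>t. norm (poly P (of_real r * cis t)))"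
    unfolding integral_unique[OF poly_coeff_integral, symmetric]
    by (intro integral_norm_bound_integral integrable_continuous_real continuous_intros) (auto simp: norm_mult)
  then show ?thesis
    using assms by (simp add: norm_mult norm_power)
qed

text \<open>
  The Hardy--Littlewood coefficient estimate. On the circle of radius \<open>r\<close> split
  \<open>\<bar>P\<bar> = \<bar>P\<bar>\<^sup>p * \<bar>P\<bar>\<^bsup>1-p\<^esup>\<close>. With the majorant \<open>g\<close>, the first factor has integral at most \<open>I\<close>, the
  integral of \<open>\<bar>P\<bar>\<^sup>p\<close> over the unit circle, and the second is at most \<open>(I / (1 - r)) powr (1 / p - 1)\<close>
  pointwise. Estimating the coefficient by the integral of \<open>\<bar>P\<bar>\<close>, rather than by its maximum, on this
  circle is what yields the exponent \<open>1 / p - 1\<close> instead of \<open>1 / p\<close>.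
\<close>
lemma Hardy_Littlewood_coeff_bound:
  fixes P :: "complex poly" and p :: real
  assumes p: "0 < p" "p \<le> 1"
  shows "norm (coeff P j) \<le> (real j + 2) powr (1 / p - 1)
     * (integral {-pi..pi} (\<lambda>t. norm (poly P (cis t)) powr p)) powr (1 / p)"
proof -
  define I where "I = integral {-pi..pi} (\<lambda>t. norm (poly P (cis t)) powr p)"
  define q where "q = 1 / p - 1"
  \<comment> \<open>With \<open>1 - r\<close> of order \<open>1 / j\<close>, the factor \<open>r ^ j\<close> stays bounded below.\<close>
  define r where "r = real (j + 1) / real (j + 2)"
  have q: "0 \<le> q" using p by (simp add: q_def)
  have r: "0 < r" "r < 1" by (auto simp: r_def)
  have r': "1 / (1 - r) = real j + 2" by (simp add: r_def field_simps)
  obtain g where g: "continuous_on (cball 0 1) g" "g holomorphic_on ball 0 1"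
    "\<And>z. norm z \<le> 1 \<Longrightarrow> norm (poly P z) powr p \<le> norm (g z)"
    "\<And>z. norm z = 1 \<Longrightarrow> norm (g z) = norm (poly P z) powr p"
    using poly_majorant[OF p(1)] by metis
  have I: "I = integral {-pi..pi} (\<lambda>t. norm (g (cis t)))"
    by (simp add: I_def g(4))
  have cg: "continuous_on {-pi..pi} (\<lambda>t. g (of_real s * cis t))" if "0 \<le> s" "s \<le> 1" for s
    by (intro continuous_intros continuous_on_compose2[OF g(1)]) (use that in \<open>auto simp: norm_mult\<close>)
  have I0: "0 \<le> I"
    unfolding I using cg[of 1] by (intro integral_nonneg integrable_continuous_real continuous_intros) auto
  \<comment> \<open>Since \<open>q = (1 - p) / p\<close>, the number \<open>(\<bar>P\<bar> powr p) powr q\<close> is \<open>\<bar>P\<bar> powr (1 - p)\<close>.\<close>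
  have pw: "norm (poly P (of_real r * cis t)) \<le> norm (g (of_real r * cis t)) * ((real j + 2) * I) powr q" for t
  proof -
    let ?z = "of_real r * cis t"
    have nz: "norm ?z = r" using r by (simp add: norm_mult)
    have "norm (g ?z) \<le> (real j + 2) * I"
      using norm_le_boundary_integral[OF g(1,2), of ?z] r nz by (simp add: I flip: r')
    then have le: "norm (poly P ?z) powr p \<le> (real j + 2) * I"
      using g(3)[of ?z] nz r by simp
    have "norm (poly P ?z) = norm (poly P ?z) powr p * (norm (poly P ?z) powr p) powr q"
    proof (cases "poly P ?z = 0")
      case False
      then show ?thesis
        using p by (simp add: powr_powr q_def algebra_simps flip: powr_add)
    qed auto
    also have "\<dots> \<le> norm (g ?z) * ((real j + 2) * I) powr q"
      using g(3)[of ?z] nz r le q by (intro mult_mono powr_mono2) auto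
    finally show ?thesis .
  qed
  have "2 * pi * norm (coeff P j) * r ^ j \<le> integral {-pi..pi} (\<lambda>t. norm (poly P (of_real r * cis t)))"
    using r by (intro norm_coeff_le_circle_integral) auto
  also have "\<dots> \<le> integral {-pi..pi} (\<lambda>t. norm (g (of_real r * cis t)) * ((real j + 2) * I) powr q)"
    using r pw by (intro integral_le integrable_continuous_real continuous_intros cg) auto
  also have "\<dots> = integral {-pi..pi} (\<lambda>t. norm (g (of_real r * cis t))) * ((real j + 2) * I) powr q"
    by simp
  also have "\<dots> \<le> I * ((real j + 2) * I) powr q"
    unfolding I using circle_integral_mono[OF g(1,2), of r] r by (intro mult_right_mono) auto
  also have "\<dots> = (real j + 2) powr q * I powr (1 / p)"
  proof (cases "I = 0")
    case False
    then have "I * I powr q = I powr (1 / p)"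
      using I0 by (simp add: q_def powr_diff)
    then show ?thesis
      using I0 by (simp add: powr_mult mult_ac)
  qed auto
  finally have main: "norm (coeff P j) * (2 * pi * r ^ j) \<le> (real j + 2) powr q * I powr (1 / p)"
    by (simp add: mult_ac)
  have "1 \<le> 2 * pi * r ^ j"
  proof -
    have "(1 + 1 / real (j + 1)) ^ j \<le> exp (1 / real (j + 1)) ^ j"
      by (intro power_mono) auto
    also have "\<dots> = exp (real j / real (j + 1))"
      by (simp flip: exp_of_nat_mult)
    also have "\<dots> \<le> exp 1" by simp
    also have "\<dots> \<le> 2 * pi" using exp_le pi_gt3 by linarith
    finally have "(1 + 1 / real (j + 1)) ^ j \<le> 2 * pi" .
    moreover have "1 + 1 / real (j + 1) = real (j + 2) / real (j + 1)"
      by (simp add: field_simps)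
    then have "(1 + 1 / real (j + 1)) ^ j * r ^ j = 1"
      by (simp add: r_def flip: power_mult_distrib)
    ultimately show ?thesis
      using r by (metis less_imp_le mult_right_mono zero_le_power)
  qed
  then have "norm (coeff P j) * 1 \<le> norm (coeff P j) * (2 * pi * r ^ j)"
    by (intro mult_left_mono) auto
  with main show ?thesis by (simp add: I_def q_def)
qed

section \<open>Coefficients of a trigonometric polynomial\<close>

lemma trig_poly_cis: "trig_poly n c x = (\<Sum>k = - int n..int n. c k * cis (of_int k * x))"
  unfolding trig_poly_def by (intro sum.cong) (auto simp: cis_conv_exp mult_ac)

definition shifted_poly :: "nat \<Rightarrow> (int \<Rightarrow> complex) \<Rightarrow> complex poly" where
  "shifted_poly n c = (\<Sum>j\<le>2 * n. monom (c (int j - int n)) j)"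

lemma coeff_shifted_poly:
  assumes "j \<le> 2 * n"
  shows "coeff (shifted_poly n c) j = c (int j - int n)"
  using assms by (simp add: shifted_poly_def coeff_sum)

lemma poly_shifted_poly_cis:
  "poly (shifted_poly n c) (cis x) = cis (real n * x) * trig_poly n c x"
proof -
  have "poly (shifted_poly n c) (cis x) = (\<Sum>j\<le>2 * n. c (int j - int n) * cis (real j * x))"
    by (simp add: shifted_poly_def poly_sum poly_monom Complex.DeMoivre)
  also have "\<dots> = (\<Sum>k = - int n..int n. c k * cis (of_int (k + int n) * x))"
    by (rule sum.reindex_bij_witness[of _ "\<lambda>k. nat (k + int n)" "\<lambda>j. int j - int n"]) auto
  also have "\<dots> = cis (real n * x) * trig_poly n c x"
    by (simp add: trig_poly_cis sum_distrib_left cis_mult[symmetric] algebra_simps)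
  finally show ?thesis .
qed

lemma continuous_on_trig_poly: "continuous_on A (trig_poly n c)"
  unfolding trig_poly_def[abs_def] by (intro continuous_intros)

lemma Lp_norm_trig_poly:
  assumes "0 < p"
  shows "Lp_norm p (trig_poly n c) =
    (integral {-pi..pi} (\<lambda>t. norm (poly (shifted_poly n c) (cis t)) powr p)) powr (1 / p)"
proof -
  have "continuous_on {-pi..pi} (\<lambda>x. norm (trig_poly n c x) powr p)"
    using assms by (intro continuous_on_powr' continuous_intros continuous_on_trig_poly) auto
  then have "set_integrable lborel {-pi..pi} (\<lambda>x. norm (trig_poly n c x) powr p)"
    by (intro borel_integrable_atLeastAtMost') 
  then show ?thesis
    by (simp add: Lp_norm_def set_borel_integral_eq_integral(2) poly_shifted_poly_cis norm_mult)
qed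

text \<open>
  Multiplication by \<open>cis (n * x)\<close>, of modulus 1, makes \<open>c k\<close> the coefficient of index \<open>k + n\<close> of an
  algebraic polynomial. The gain is for \<open>k\<close> close to the left end \<open>- n\<close>.
\<close>
lemma trig_poly_coeff_bound_left:
  assumes p: "0 < p" "p \<le> 1" and k: "\<bar>k\<bar> \<le> int n"
  shows "norm (c k) \<le> (real_of_int (k + int n) + 2) powr (1 / p - 1) * Lp_norm p (trig_poly n c)"
proof -
  have k0: "0 \<le> k + int n" using k by auto
  have "nat (k + int n) \<le> 2 * n" using k by auto
  then show ?thesis
    using Hardy_Littlewood_coeff_bound[OF p, of "shifted_poly n c" "nat (k + int n)"] k k0
    by (simp add: coeff_shifted_poly Lp_norm_trig_poly p)
qed

text \<open>
  Conjugation reflects the frequencies and preserves the modulus, which carries the bound near \<open>- n\<close>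
  over to frequencies near \<open>n\<close>.
\<close>
lemma cnj_trig_poly: "cnj (trig_poly n c x) = trig_poly n (\<lambda>k. cnj (c (- k))) x"
proof -
  have "cnj (trig_poly n c x) = (\<Sum>k = - int n..int n. cnj (c k) * cis (- (of_int k * x)))"
    by (simp add: trig_poly_cis cis_cnj)
  also have "\<dots> = (\<Sum>k = - int n..int n. cnj (c (- k)) * cis (of_int k * x))"
    by (rule sum.reindex_bij_witness[of _ uminus uminus]) auto
  finally show ?thesis by (simp add: trig_poly_cis)
qed

lemma Lp_norm_cong_norm:
  assumes "\<And>x. norm (f x) = norm (g x)"
  shows "Lp_norm p f = Lp_norm p g"
  by (simp add: Lp_norm_def assms)

lemma trig_poly_coeff_bound:
  assumes p: "0 < p" "p \<le> 1" and k: "\<bar>k\<bar> \<le> int n"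
  shows "norm (c k) \<le> (real_of_int (int n - \<bar>k\<bar>) + 2) powr (1 / p - 1) * Lp_norm p (trig_poly n c)"
proof (cases "k \<le> 0")
  case True
  then show ?thesis using trig_poly_coeff_bound_left[OF assms, of c] by (simp add: add.commute)
next
  case False
  have "Lp_norm p (trig_poly n (\<lambda>k. cnj (c (- k)))) = Lp_norm p (trig_poly n c)"
    by (rule Lp_norm_cong_norm) (simp flip: cnj_trig_poly)
  then show ?thesis
    using trig_poly_coeff_bound_left[OF p, of "- k" n "\<lambda>k. cnj (c (- k))"] k False
    by (simp add: add.commute)
qed

section \<open>Derivatives of a trigonometric polynomial\<close>

lemma vector_derivative_trig_poly:
  "vector_derivative (trig_poly n c) (at x) = trig_poly n (\<lambda>k. c k * (\<i> * of_int k)) x"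
proof (rule vector_derivative_at)
  show "(trig_poly n c has_vector_derivative trig_poly n (\<lambda>k. c k * (\<i> * of_int k)) x) (at x)"
    unfolding trig_poly_cis[abs_def] mult.assoc
    using has_vector_derivative_cis_mult[of "of_int k" x UNIV for k, simplified]
    by (intro has_vector_derivative_sum has_vector_derivative_mult_right) (simp add: mult_ac)
qed

lemma nth_deriv_trig_poly:
  "nth_deriv s (trig_poly n c) = trig_poly n (\<lambda>k. c k * (\<i> * of_int k) ^ s)"
proof (induction s)
  case (Suc s)
  have "nth_deriv (Suc s) (trig_poly n c) = (\<lambda>x. vector_derivative (nth_deriv s (trig_poly n c)) (at x))"
    by (simp add: nth_deriv_def)
  then show ?case
    by (simp add: Suc vector_derivative_trig_poly mult_ac)
qed (simp add: nth_deriv_def)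

lemma sup_norm_nth_deriv_le:
  "sup_norm (nth_deriv s (trig_poly n c)) \<le> (\<Sum>k = - int n..int n. norm (c k) * real_of_int \<bar>k\<bar> ^ s)"
  unfolding sup_norm_def nth_deriv_trig_poly trig_poly_cis
  by (intro cSUP_least sum_norm_le) (auto simp: norm_mult norm_power)

section \<open>The weighted exponential sum\<close>

lemma powr_le_const_mult_exp:
  fixes u a :: real
  assumes "0 \<le> u" "1 \<le> a"
  shows "u powr (a - 1) \<le> (2 * a) powr (a - 1) * exp (u / 2)"
proof -
  have "u / (2 * a) \<le> exp (u / (2 * a))"
    using exp_ge_add_one_self[of "u / (2 * a)"] by linarith
  then have "(u / (2 * a)) powr (a - 1) \<le> exp (u / (2 * a)) powr (a - 1)"
    using assms by (intro powr_mono2) auto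
  also have "\<dots> = exp (u / 2 * ((a - 1) / a))"
    by (simp add: powr_def field_simps)
  also have "\<dots> \<le> exp (u / 2 * 1)"
    using assms by (intro exp_mono mult_left_mono) (auto simp: field_simps)
  finally have "(u / (2 * a)) powr (a - 1) \<le> exp (u / 2)" by simp
  then have "(2 * a) powr (a - 1) * (u / (2 * a)) powr (a - 1) \<le> (2 * a) powr (a - 1) * exp (u / 2)"
    by (intro mult_left_mono) auto
  moreover have "(2 * a) powr (a - 1) * (u / (2 * a)) powr (a - 1) = u powr (a - 1)"
    using assms by (simp add: powr_divide)
  ultimately show ?thesis by simp
qed

lemma geometric_exp_sum_le:
  fixes y :: real
  assumes "0 < y" "y \<le> 1"
  shows "(\<Sum>j\<le>n. exp (- (y * real j / 2))) \<le> 3 / y"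
proof -
  define e where "e = exp (- (y / 2))"
  have e: "0 < e" "e < 1" using assms by (auto simp: e_def)
  have "exp (- (y * real j / 2)) = e ^ j" for j
    by (simp add: e_def field_simps flip: exp_of_nat_mult)
  then have "(\<Sum>j\<le>n. exp (- (y * real j / 2))) = (1 - e ^ Suc n) / (1 - e)"
    using e by (simp add: sum_gp0)
  also have "\<dots> \<le> 1 / (1 - e)"
    using e by (intro divide_right_mono) auto
  also have "\<dots> \<le> 3 / y"
  proof -
    have "1 + y / 2 \<le> exp (y / 2)" by (rule exp_ge_add_one_self)
    then have "e * (1 + y / 2) \<le> e * exp (y / 2)" using e by (intro mult_left_mono) auto
    also have "\<dots> = 1" by (simp add: e_def flip: exp_add)
    finally have "e \<le> 1 / (1 + y / 2)" using assms by (simp add: field_simps)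
    also have "\<dots> = 1 - y / (2 + y)" using assms by (simp add: field_simps)
    also have "\<dots> \<le> 1 - y / 3" 
      using assms divide_left_mono[of "2 + y" 3 y] by simp
    finally have "y \<le> 3 * (1 - e)" by simp
    then show ?thesis using e assms by (simp add: field_simps)
  qed
  finally show ?thesis .
qed

text \<open>
  The sum behaves like the Gamma integral of \<open>t powr (a - 1) * exp (- x * t)\<close>, which is of order
  \<open>x powr (- a)\<close> for small \<open>x\<close>; for large \<open>x\<close> the first term keeps it of order 1. Replacing \<open>x\<close> by
  \<open>y = min x 1\<close> treats both ranges at once: half of the exponential decay absorbs the power, and the
  other half leaves a geometric series.
\<close>
lemma weighted_exp_sum_le:
  fixes a x :: real
  assumes a: "1 \<le> a" and x: "0 < x"
  shows "(\<Sum>j\<le>n. (real j + 2) powr (a - 1) * exp (- (x * real j)))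
    \<le> 9 * (2 * a) powr (a - 1) * (1 + x powr (- a))"
proof -
  define y where "y = min x 1"
  have y: "0 < y" "y \<le> 1" "y \<le> x" using x by (auto simp: y_def)
  define M where "M = (2 * a) powr (a - 1)"
  have M: "0 \<le> M" by (simp add: M_def)
  have "(real j + 2) powr (a - 1) * exp (- (x * real j)) \<le> 3 * M * y powr (1 - a) * exp (- (y * real j / 2))" for j
  proof -
    have "y powr (1 - a) * y powr (a - 1) = 1"
      using y by (simp flip: powr_add)
    then have "(real j + 2) powr (a - 1) = y powr (1 - a) * (y * (real j + 2)) powr (a - 1)"
      using y by (simp add: powr_mult)
    also have "\<dots> \<le> y powr (1 - a) * (M * exp (y * (real j + 2) / 2))"
      unfolding M_def using y a by (intro mult_left_mono powr_le_const_mult_exp) auto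
    also have "\<dots> = M * y powr (1 - a) * exp (y * real j / 2) * exp y"
      by (simp add: field_simps flip: exp_add)
    also have "\<dots> \<le> M * y powr (1 - a) * exp (y * real j / 2) * 3"
      using y M exp_le exp_mono[of y 1] by (intro mult_left_mono) (auto simp del: exp_le_cancel_iff)
    finally have 1: "(real j + 2) powr (a - 1) \<le> M * y powr (1 - a) * exp (y * real j / 2) * 3" .
    have 2: "exp (- (x * real j)) \<le> exp (- (y * real j))"
      using y by (simp add: mult_right_mono)
    have "(real j + 2) powr (a - 1) * exp (- (x * real j))
       \<le> (M * y powr (1 - a) * exp (y * real j / 2) * 3) * exp (- (y * real j))"
      using 1 2 M by (intro mult_mono) auto
    also have "\<dots> = 3 * M * y powr (1 - a) * (exp (y * real j / 2) * exp (- (y * real j)))"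
      by simp
    also have "exp (y * real j / 2) * exp (- (y * real j)) = exp (- (y * real j / 2))"
      by (simp flip: exp_add)
    finally show ?thesis .
  qed
  then have "(\<Sum>j\<le>n. (real j + 2) powr (a - 1) * exp (- (x * real j)))
     \<le> (\<Sum>j\<le>n. 3 * M * y powr (1 - a) * exp (- (y * real j / 2)))"
    by (intro sum_mono)
  also have "\<dots> = 3 * M * y powr (1 - a) * (\<Sum>j\<le>n. exp (- (y * real j / 2)))"
    by (simp add: sum_distrib_left)
  also have "\<dots> \<le> 3 * M * y powr (1 - a) * (3 / y)"
    using M y by (intro mult_left_mono geometric_exp_sum_le) auto
  also have "\<dots> = 9 * M * y powr (- a)"
    using y by (simp add: powr_diff powr_minus field_simps)
  also have "\<dots> \<le> 9 * M * (1 + x powr (- a))"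
    using M by (intro mult_left_mono) (auto simp: y_def min_def)
  finally show ?thesis by (simp add: M_def)
qed

section \<open>The weighted coefficient sum\<close>

lemma sum_symmetric_le:
  fixes f :: "nat \<Rightarrow> real"
  assumes "\<And>m. 0 \<le> f m"
  shows "(\<Sum>k = - int n..int n. f (nat \<bar>k\<bar>)) \<le> 2 * (\<Sum>m\<le>n. f m)"
proof -
  have "{- int n..int n} \<subseteq> int ` {..n} \<union> (uminus \<circ> int) ` {..n}"
  proof
    fix k assume "k \<in> {- int n..int n}"
    then show "k \<in> int ` {..n} \<union> (uminus \<circ> int) ` {..n}"
      by (cases "0 \<le> k") (auto simp: image_iff intro: bexI[of _ "nat k"] bexI[of _ "nat (- k)"])
  qed
  then have "(\<Sum>k = - int n..int n. f (nat \<bar>k\<bar>)) \<le> (\<Sum>k\<in>int ` {..n} \<union> (uminus \<circ> int) ` {..n}. f (nat \<bar>k\<bar>))"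
    using assms by (intro sum_mono2) auto
  also have "\<dots> \<le> (\<Sum>k\<in>int ` {..n}. f (nat \<bar>k\<bar>)) + (\<Sum>k\<in>(uminus \<circ> int) ` {..n}. f (nat \<bar>k\<bar>))"
    using assms by (subst sum_Un) (auto intro!: sum_nonneg)
  also have "\<dots> = 2 * (\<Sum>m\<le>n. f m)"
    by (simp add: sum.reindex inj_on_def)
  finally show ?thesis .
qed

lemma power_diff_le_exp:
  assumes "1 \<le> n" "j \<le> n"
  shows "real (n - j) ^ s \<le> real n ^ s * exp (- (real s / real n * real j))"
proof -
  have "real (n - j) = real n * (1 + - (real j / real n))"
    using assms by (simp add: field_simps of_nat_diff)
  also have "\<dots> \<le> real n * exp (- (real j / real n))"
    by (intro mult_left_mono exp_ge_add_one_self) auto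
  finally have "real (n - j) ^ s \<le> (real n * exp (- (real j / real n))) ^ s"
    by (intro power_mono) auto
  also have "\<dots> = real n ^ s * exp (- (real s / real n * real j))"
    by (simp add: power_mult_distrib flip: exp_of_nat_mult)
  finally show ?thesis .
qed

text \<open>
  With \<open>j = n - \<bar>k\<bar>\<close>, the distance of the frequency from the end of the spectrum, the coefficient is at most
  \<open>(j + 2) powr (1 / p - 1)\<close> times the norm, and its weight \<open>(n - j) ^ s\<close> is at most
  \<open>n ^ s * exp (- (s / n) * j)\<close>. What remains is the exponential sum above with \<open>x = s / n\<close>.
\<close>
lemma weighted_coeff_sum_le:
  assumes p: "0 < p" "p \<le> 1" and n: "1 \<le> n" and s: "1 \<le> s"
  shows "(\<Sum>k = - int n..int n. norm (c k) * real_of_int \<bar>k\<bar> ^ s)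
      \<le> 18 * (2 / p) powr (1 / p - 1)
          * (real n ^ s * (1 + (real n / real s) powr (1 / p)) * Lp_norm p (trig_poly n c))"
proof -
  define A where "A = Lp_norm p (trig_poly n c)"
  define a where "a = 1 / p"
  define x where "x = real s / real n"
  have a: "1 \<le> a" using p by (simp add: a_def)
  have x: "0 < x" using n s by (simp add: x_def)
  have A: "0 \<le> A" by (simp add: A_def Lp_norm_def)
  have "(\<Sum>k = - int n..int n. norm (c k) * real_of_int \<bar>k\<bar> ^ s)
     \<le> (\<Sum>k = - int n..int n. (real (n - nat \<bar>k\<bar>) + 2) powr (a - 1) * A * real (nat \<bar>k\<bar>) ^ s)"
  proof (intro sum_mono)
    fix k assume "k \<in> {- int n..int n}"
    then have k: "\<bar>k\<bar> \<le> int n" by auto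
    then have "real (n - nat \<bar>k\<bar>) = real_of_int (int n - \<bar>k\<bar>)"
      by (simp add: of_nat_diff nat_le_iff)
    then have "norm (c k) \<le> (real (n - nat \<bar>k\<bar>) + 2) powr (a - 1) * A"
      using trig_poly_coeff_bound[OF p k, of c] by (simp only: a_def A_def)
    then show "norm (c k) * real_of_int \<bar>k\<bar> ^ s \<le> (real (n - nat \<bar>k\<bar>) + 2) powr (a - 1) * A * real (nat \<bar>k\<bar>) ^ s"
      by (simp add: mult_right_mono)
  qed
  also have "\<dots> \<le> 2 * (\<Sum>m\<le>n. (real (n - m) + 2) powr (a - 1) * A * real m ^ s)"
    using A by (intro sum_symmetric_le) auto
  also have "(\<Sum>m\<le>n. (real (n - m) + 2) powr (a - 1) * A * real m ^ s)
     = (\<Sum>j\<le>n. (real j + 2) powr (a - 1) * A * real (n - j) ^ s)"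
    by (rule sum.reindex_bij_witness[of _ "\<lambda>j. n - j" "\<lambda>j. n - j"]) auto
  also have "\<dots> \<le> (\<Sum>j\<le>n. (real j + 2) powr (a - 1) * A * (real n ^ s * exp (- (x * real j))))"
    unfolding x_def using A n by (intro sum_mono mult_left_mono power_diff_le_exp) auto
  also have "\<dots> = A * real n ^ s * (\<Sum>j\<le>n. (real j + 2) powr (a - 1) * exp (- (x * real j)))"
    by (simp add: sum_distrib_left mult_ac)
  also have "\<dots> \<le> A * real n ^ s * (9 * (2 * a) powr (a - 1) * (1 + x powr (- a)))"
    using A by (intro mult_left_mono weighted_exp_sum_le a x) auto
  also have "x powr (- a) = (real n / real s) powr a"
    using n s by (simp add: x_def powr_minus powr_divide)
  finally show ?thesis
    by (simp add: A_def a_def mult_ac)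
qed

theorem lemma3p5:
  fixes p :: real
  assumes "0 < p" and "p \<le> 1"
  shows "\<exists>C>0. \<forall>(n::nat) (s::nat) (c :: int \<Rightarrow> complex). n \<ge> 1 \<longrightarrow> s \<ge> 1 \<longrightarrow>
    sup_norm (nth_deriv s (trig_poly n c)) \<le> (\<Sum>k = - int n..int n. norm (c k) * real_of_int \<bar>k\<bar> ^ s) \<and>
    (\<Sum>k = - int n..int n. norm (c k) * real_of_int \<bar>k\<bar> ^ s)
      \<le> C * (real n ^ s * (1 + (real n / real s) powr (1 / p)) * Lp_norm p (trig_poly n c))"
proof (intro exI[of _ "18 * (2 / p) powr (1 / p - 1)"] conjI allI impI)
  show "0 < 18 * (2 / p) powr (1 / p - 1)"
    using assms by simp
qed (rule sup_norm_nth_deriv_le weighted_coeff_sum_le[OF assms]; assumption)+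

end
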